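(* Let $p$ be a positive integer. For $n\ge 0$, let $\mathcal{B}^{(p)}_n$ denote the set of $p$-Fibonacci polyominoes with $n$ columns (with $\mathcal{B}^{(p)}_0$ consisting only of the empty polyomino), and define \[G_p(x;q)=\sum_{n\ge 0}x^n\sum_{P\in\mathcal{B}^{(p)}_n} q^{\mathrm{inn}(P)}.\] Then \[G_p(x;q)=1+\frac{\sum_{i=1}^{p}x^{p-i+1}q^{\frac12(p-i)(p+i-3)}}{1-\sum_{i=1}^{p}x^{p-i+1}q^{\frac12\left((p-i)(p+i-3)+2(i-1)\right)}}.\]
   Context: A $p$-Fibonacci word of length $n\ge 1$ is a word $u=u_1u_2\cdots u_n$ over $\{1,\dots,p\}$ with $u_1=p$ and, for $1\le i\le n-1$: if $u_i=1$ then $u_{i+1}=p$; if $2\le u_i\le p$ then $u_{i+1}\in\{u_i-1,\,p\}$. The empty word is the unique $p$-Fibonacci word of length $0$. Each such word $u$ determines a polyomino (bargraph) with $n$ columns: $n$ adjacent columns of unit square cells resting on a common horizontal base line, the $i$-th column having $u_i$ cells; these are the $p$-Fibonacci polyominoes. An inner point of a polyomino $P$ is a lattice point that does not lie on the boundary of $P$, equivalently a lattice point that is a corner of exactly four cells of $P$; $\mathrm{inn}(P)$ denotes the number of inner points of $P$ (the empty polyomino has $0$ inner points). *)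

theory Defs
  imports "HOL-Computational_Algebra.Computational_Algebra"
begin

definition fibonacci_word :: "nat \<Rightarrow> nat list \<Rightarrow> bool" where
  "fibonacci_word p u \<longleftrightarrow>
     set u \<subseteq> {1..p} \<and>
     (u \<noteq> [] \<longrightarrow> hd u = p) \<and>
     (\<forall>i. Suc i < length u \<longrightarrow>
        (u ! i = 1 \<longrightarrow> u ! Suc i = p) \<and>
        (2 \<le> u ! i \<and> u ! i \<le> p \<longrightarrow> u ! Suc i \<in> {u ! i - 1, p}))"

text \<open>A unit square cell is named by its lower left corner, a polyomino is its set of cells,
  and the leftmost bottom cell of a bargraph is \<open>(0, 0)\<close>.\<close>

type_synonym cell = "int \<times> int"

definition bargraph :: "nat list \<Rightarrow> cell set" where
  "bargraph u = {(int i, int j) | i j. i < length u \<and> j < u ! i}"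

definition fibonacci_polyominoes :: "nat \<Rightarrow> nat \<Rightarrow> cell set set" where
  "fibonacci_polyominoes p n = bargraph ` {u. fibonacci_word p u \<and> length u = n}"

definition corners :: "cell \<Rightarrow> (int \<times> int) set" where
  "corners c = (case c of (a, b) \<Rightarrow> {(a, b), (a + 1, b), (a, b + 1), (a + 1, b + 1)})"

definition inner_points :: "cell set \<Rightarrow> (int \<times> int) set" where
  "inner_points P = {z. card {c \<in> P. z \<in> corners c} = 4}"

definition inn :: "cell set \<Rightarrow> nat" where
  "inn P = card (inner_points P)"

text \<open>Generating functions are power series in \<open>x\<close> (\<^const>\<open>fps_X\<close>) over the field of fractions of
  the polynomials in the indeterminate \<open>q\<close>.\<close>

definition qvar :: "int poly fract" where
  "qvar = to_fract [:0, 1:]"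

definition fibonacci_gf :: "nat \<Rightarrow> int poly fract fps" where
  "fibonacci_gf p = Abs_fps (\<lambda>n. \<Sum>P\<in>fibonacci_polyominoes p n. qvar ^ inn P)"

end

theory Submission
  imports Defs
begin

text \<open>Two adjacent columns of heights \<open>a, b\<close> share \<open>min a b - 1\<close> inner points, so \<open>q\<^bsup>inn\<^esup>\<close> is a
  product of weights of consecutive letters. If \<open>W\<^sub>k\<close> is the weighted generating function of the
  nonempty words that start with \<open>k\<close> and obey the succession rule, removing the first letter gives
  \<open>W\<^sub>1 = x (1 + W\<^sub>p)\<close> and \<open>W\<^sub>k = x (1 + q\<^bsup>k-1\<^esup> W\<^sub>p) + x q\<^bsup>k-2\<^esup> W\<^bsub>k-1\<^esub>\<close>. Unrolling this down to
  \<open>k = 1\<close> turns the case \<open>k = p\<close> into a linear equation for \<open>W\<^sub>p\<close>, and \<open>G\<^sub>p = 1 + W\<^sub>p\<close>.\<close>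

section \<open>Inner points of a bargraph\<close>

definition bargraph_weight :: "nat list \<Rightarrow> nat" where
  "bargraph_weight u = (\<Sum>i<length u - 1. min (u ! i) (u ! Suc i) - 1)"

lemma bargraph_weight_simps [simp]:
  "bargraph_weight [] = 0"
  "bargraph_weight [k] = 0"
  "bargraph_weight (k # l # u) = (min k l - 1) + bargraph_weight (l # u)"
  by (simp_all add: bargraph_weight_def sum.lessThan_Suc_shift del: sum.lessThan_Suc)

lemma mem_bargraph_iff:
  "(a, b) \<in> bargraph u \<longleftrightarrow> 0 \<le> a \<and> nat a < length u \<and> 0 \<le> b \<and> nat b < u ! nat a"
proof
  assume "0 \<le> a \<and> nat a < length u \<and> 0 \<le> b \<and> nat b < u ! nat a"
  then show "(a, b) \<in> bargraph u"
    unfolding bargraph_def by (intro CollectI exI[of _ "nat a"] exI[of _ "nat b"]) auto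
qed (auto simp: bargraph_def)

text \<open>Only the four cells around a lattice point have it as a corner, so the count is 4
  exactly when all of them lie in \<open>P\<close>.\<close>

lemma inner_points_iff:
  "(a, b) \<in> inner_points P \<longleftrightarrow> {(a, b), (a - 1, b), (a, b - 1), (a - 1, b - 1)} \<subseteq> P"
proof -
  let ?N = "{(a, b), (a - 1, b), (a, b - 1), (a - 1, b - 1)}"
  have eq: "{c \<in> P. (a, b) \<in> corners c} = P \<inter> ?N"
    by (auto simp: corners_def)
  have N: "finite ?N" "card ?N = 4"
    by auto
  have "card (P \<inter> ?N) = 4 \<longleftrightarrow> ?N \<subseteq> P"
  proof
    assume "card (P \<inter> ?N) = 4"
    then have "P \<inter> ?N = ?N"
      using N by (intro card_subset_eq) auto
    then show "?N \<subseteq> P" by blast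
  next
    assume "?N \<subseteq> P"
    then have "P \<inter> ?N = ?N" by blast
    then show "card (P \<inter> ?N) = 4" using N by metis
  qed
  then show ?thesis
    by (simp only: inner_points_def mem_Collect_eq eq)
qed

text \<open>An inner point lies on the line between two adjacent columns, strictly above the base
  line and strictly below both tops.\<close>

lemma inner_points_bargraph:
  "inner_points (bargraph u) =
     (\<lambda>(i, j). (int (Suc i), int j)) `
       (SIGMA i:{..<length u - 1}. {1..<min (u ! i) (u ! Suc i)})"
  (is "_ = ?f ` ?S")
proof (intro set_eqI iffI)
  fix z assume z: "z \<in> inner_points (bargraph u)"
  obtain a b where ab: "z = (a, b)" by fastforce
  have "(a, b) \<in> bargraph u" "(a - 1, b) \<in> bargraph u" "(a - 1, b - 1) \<in> bargraph u"
    using z by (auto simp: ab inner_points_iff)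
  then have *: "1 \<le> a" "nat a < length u" "1 \<le> b" "nat b < u ! nat a" "nat b < u ! nat (a - 1)"
    by (auto simp: mem_bargraph_iff)
  have "Suc (nat (a - 1)) = nat a" using * by simp
  then have "(nat (a - 1), nat b) \<in> ?S" using * by auto
  moreover have "z = ?f (nat (a - 1), nat b)" using * by (simp add: ab)
  ultimately show "z \<in> ?f ` ?S" by blast
next
  fix z assume "z \<in> ?f ` ?S"
  then obtain i j where "z = (int (Suc i), int j)" "Suc i < length u" "1 \<le> j" "j < u ! i"
    "j < u ! Suc i"
    by auto
  then show "z \<in> inner_points (bargraph u)"
    by (auto simp: inner_points_iff mem_bargraph_iff nat_diff_distrib nat_add_distrib)
qed

lemma inn_bargraph: "inn (bargraph u) = bargraph_weight u"
proof -
  have "inj_on (\<lambda>(i, j). (int (Suc i), int j)) A" for A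
    by (auto simp: inj_on_def)
  then show ?thesis
    by (simp add: inn_def inner_points_bargraph card_image bargraph_weight_def)
qed

text \<open>The cells over each position determine the height there. The length is fixed because
  trailing columns of height 0 leave no trace.\<close>

lemma inj_on_bargraph: "inj_on bargraph {u. length u = n}"
proof (rule inj_onI)
  fix u v :: "nat list"
  assume len: "u \<in> {u. length u = n}" "v \<in> {u. length u = n}" and eq: "bargraph u = bargraph v"
  have "u ! i = v ! i" if "i < n" for i
  proof -
    have "j < u ! i \<longleftrightarrow> j < v ! i" for j
      using that len eq mem_bargraph_iff[of "int i" "int j" u] mem_bargraph_iff[of "int i" "int j" v]
      by simp
    then show ?thesis by (meson linorder_neqE_nat less_irrefl)
  qed
  then show "u = v" using len by (auto intro: nth_equalityI)
qed

section \<open>Words with a prescribed first letter\<close>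

definition fibonacci_step :: "nat \<Rightarrow> nat \<Rightarrow> nat \<Rightarrow> bool" where
  "fibonacci_step p a b \<longleftrightarrow> (a = 1 \<longrightarrow> b = p) \<and> (2 \<le> a \<and> a \<le> p \<longrightarrow> b \<in> {a - 1, p})"

text \<open>The start \<open>k\<close> is free because deleting the first letter of a word starting
  with \<open>p\<close> may leave one that starts with another letter.\<close>

definition fibonacci_paths :: "nat \<Rightarrow> nat \<Rightarrow> nat \<Rightarrow> nat list set" where
  "fibonacci_paths p k n =
     {u. length u = n \<and> u \<noteq> [] \<and> hd u = k \<and> successively (fibonacci_step p) u}"

lemma fibonacci_paths_0 [simp]: "fibonacci_paths p k 0 = {}"
  by (auto simp: fibonacci_paths_def)

text \<open>The case \<open>n = 0\<close> supplies the empty tail, which no set of paths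
  contains.\<close>

lemma fibonacci_paths_Suc:
  "fibonacci_paths p k (Suc n) =
     (#) k ` ((if n = 0 then {[]} else {}) \<union> (\<Union>l\<in>Collect (fibonacci_step p k). fibonacci_paths p l n))"
proof (intro set_eqI iffI)
  fix u assume u: "u \<in> fibonacci_paths p k (Suc n)"
  then obtain v where v: "u = k # v" "length v = n"
    by (auto simp: fibonacci_paths_def length_Suc_conv)
  then show "u \<in> (#) k ` ((if n = 0 then {[]} else {}) \<union>
      (\<Union>l\<in>Collect (fibonacci_step p k). fibonacci_paths p l n))"
    using u by (cases v) (auto simp: fibonacci_paths_def)
next
  fix u assume "u \<in> (#) k ` ((if n = 0 then {[]} else {}) \<union>
      (\<Union>l\<in>Collect (fibonacci_step p k). fibonacci_paths p l n))"
  then show "u \<in> fibonacci_paths p k (Suc n)"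
    by (auto simp: fibonacci_paths_def successively_Cons split: if_splits)
qed

lemma Collect_fibonacci_step:
  assumes "1 \<le> k" "k \<le> p"
  shows "Collect (fibonacci_step p k) = (if k = 1 then {p} else {k - 1, p})"
  using assms by (auto simp: fibonacci_step_def)

text \<open>The step rule never leaves \<open>{1..p}\<close>. This yields the bound on letters in
  \<open>fibonacci_word\<close>, and finiteness.\<close>

lemma set_fibonacci_paths:
  assumes "1 \<le> k" "k \<le> p" "u \<in> fibonacci_paths p k n"
  shows "set u \<subseteq> {1..p}"
  using assms
proof (induction n arbitrary: k u)
  case (Suc n)
  have "1 \<le> l \<and> l \<le> p" if "fibonacci_step p k l" for l
    using that Suc.prems(1,2) by (auto simp: fibonacci_step_def)
  then show ?case
    using Suc by (fastforce simp: fibonacci_paths_Suc split: if_splits)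
qed simp

lemma finite_fibonacci_paths:
  assumes "1 \<le> k" "k \<le> p"
  shows "finite (fibonacci_paths p k n)"
proof (rule finite_subset)
  show "fibonacci_paths p k n \<subseteq> {u. set u \<subseteq> {1..p} \<and> length u = n}"
    using set_fibonacci_paths[OF assms] by (auto simp: fibonacci_paths_def)
qed (simp add: finite_lists_length_eq)

lemma fibonacci_words_eq_paths:
  assumes "1 \<le> p" "0 < n"
  shows "{u. fibonacci_word p u \<and> length u = n} = fibonacci_paths p p n"
proof (intro set_eqI iffI)
  fix u assume "u \<in> {u. fibonacci_word p u \<and> length u = n}"
  then show "u \<in> fibonacci_paths p p n"
    using assms
    by (auto simp: fibonacci_word_def fibonacci_paths_def successively_conv_nth fibonacci_step_def)
next
  fix u assume u: "u \<in> fibonacci_paths p p n"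
  then have "set u \<subseteq> {1..p}"
    using assms set_fibonacci_paths by blast
  with u show "u \<in> {u. fibonacci_word p u \<and> length u = n}"
    by (auto simp: fibonacci_word_def fibonacci_paths_def successively_conv_nth fibonacci_step_def)
qed

section \<open>Generating functions by first letter\<close>

definition paths_gf :: "'a::comm_ring_1 \<Rightarrow> nat \<Rightarrow> nat \<Rightarrow> 'a fps" where
  "paths_gf q p k = Abs_fps (\<lambda>n. \<Sum>u\<in>fibonacci_paths p k n. q ^ bargraph_weight u)"

text \<open>Prefixing \<open>k\<close> creates just one new adjacent pair, \<open>k\<close> and
  \<open>l\<close>.\<close>

lemma sum_Cons_paths:
  "(\<Sum>u\<in>(#) k ` fibonacci_paths p l n. q ^ bargraph_weight u) =
     q ^ (min k l - 1) * (paths_gf q p l $ n)"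
proof -
  have "q ^ bargraph_weight (k # u) = q ^ (min k l - 1) * q ^ bargraph_weight u"
    if "u \<in> fibonacci_paths p l n" for u
    using that by (cases u) (auto simp: fibonacci_paths_def power_add)
  then show ?thesis
    by (simp add: paths_gf_def sum.reindex sum_distrib_left)
qed

lemma paths_gf_nth_Suc:
  assumes "1 \<le> k" "k \<le> p"
  shows "paths_gf q p k $ Suc n =
    (if n = 0 then 1 else 0) + (\<Sum>l\<in>Collect (fibonacci_step p k). q ^ (min k l - 1) * paths_gf q p l $ n)"
proof -
  let ?w = "\<lambda>u. q ^ bargraph_weight u" and ?L = "Collect (fibonacci_step p k)"
  have L: "finite ?L" "\<And>l. l \<in> ?L \<Longrightarrow> finite (fibonacci_paths p l n)"
    using assms by (auto simp: Collect_fibonacci_step intro!: finite_fibonacci_paths split: if_splits)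
  have "paths_gf q p k $ Suc n =
      sum ?w ((#) k ` (if n = 0 then {[]} else {}) \<union> (\<Union>l\<in>?L. (#) k ` fibonacci_paths p l n))"
    by (simp add: paths_gf_def fibonacci_paths_Suc image_Un image_UN)
  also have "\<dots> = sum ?w ((#) k ` (if n = 0 then {[]} else {}))
      + sum ?w (\<Union>l\<in>?L. (#) k ` fibonacci_paths p l n)"
    \<comment> \<open>Paths are nonempty, so \<open>[k]\<close> is not among the words
      \<open>k # u\<close>.\<close>
    using L by (intro sum.union_disjoint) (auto simp: fibonacci_paths_def)
  also have "sum ?w (\<Union>l\<in>?L. (#) k ` fibonacci_paths p l n)
      = (\<Sum>l\<in>?L. sum ?w ((#) k ` fibonacci_paths p l n))"
    \<comment> \<open>The second letter \<open>l\<close> separates the sets.\<close>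
    using L by (intro sum.UNION_disjoint) (auto simp: fibonacci_paths_def)
  also have "sum ?w ((#) k ` (if n = 0 then {[]} else {})) = (if n = 0 then 1 else 0)"
    by simp
  finally show ?thesis by (simp only: sum_Cons_paths)
qed

lemma paths_gf_1:
  assumes "1 \<le> p"
  shows "paths_gf q p 1 = fps_X * (1 + paths_gf q p p)"
proof (rule fps_ext)
  fix n show "paths_gf q p 1 $ n = (fps_X * (1 + paths_gf q p p)) $ n"
    using assms paths_gf_nth_Suc[of 1 p q "n - 1"] Collect_fibonacci_step[of 1 p]
    by (cases n) (auto simp: paths_gf_def)
qed

lemma paths_gf_Suc:
  assumes "1 \<le> k" "Suc k \<le> p"
  shows "paths_gf q p (Suc k) =
    fps_X * (1 + fps_const (q ^ k) * paths_gf q p p)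
      + fps_X * fps_const (q ^ (k - 1)) * paths_gf q p k"
proof (rule fps_ext)
  fix n show "paths_gf q p (Suc k) $ n =
    (fps_X * (1 + fps_const (q ^ k) * paths_gf q p p)
      + fps_X * fps_const (q ^ (k - 1)) * paths_gf q p k) $ n"
  proof (cases n)
    case 0
    then show ?thesis by (simp add: paths_gf_def mult.assoc)
  next
    case (Suc m)
    \<comment> \<open>The successors \<open>k\<close> and \<open>p\<close> of \<open>Suc k\<close>
      are distinct, so the sum over them has two terms.\<close>
    have "min (Suc k) p = Suc k" "k \<noteq> p" using assms by auto
    then show ?thesis
      using assms paths_gf_nth_Suc[of "Suc k" p q m] Collect_fibonacci_step[of "Suc k" p] Suc
      by (simp add: mult.assoc algebra_simps)
  qed
qed

text \<open>The exponent of \<open>q\<close> collected on the descent k, k - 1, ..., i: the pair j +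
  1, j contributes \<open>j - 1\<close>.\<close>

definition descent_weight :: "nat \<Rightarrow> nat \<Rightarrow> nat" where
  "descent_weight k i = (\<Sum>j = i..<k. j - 1)"

text \<open>Doubling avoids division, and integers are used because the last factor is negative at
  \<open>i = k = 1\<close>.\<close>

lemma int_descent_weight:
  assumes "1 \<le> i" "i \<le> k"
  shows "2 * int (descent_weight k i) = (int k - int i) * (int k + int i - 3)"
  using assms(2,1)
proof (induction k rule: dec_induct)
  case (step k)
  then have "2 * int (descent_weight (Suc k) i) = 2 * int (descent_weight k i) + 2 * (int k - 1)"
    by (simp add: descent_weight_def of_nat_diff)
  then show ?case using step by (simp add: algebra_simps)
qed (simp add: descent_weight_def)

text \<open>Summand \<open>i\<close> collects the words that descend from \<open>k\<close> to
  \<open>i\<close> and then either end or jump to \<open>p\<close>, the jump costing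
  \<open>i - 1\<close>.\<close>

lemma paths_gf_unroll:
  assumes "1 \<le> k" "k \<le> p"
  shows "paths_gf q p k = (\<Sum>i = 1..k. fps_X ^ (k - i + 1) *
    fps_const (q ^ descent_weight k i) * (1 + fps_const (q ^ (i - 1)) * paths_gf q p p))"
  using assms
proof (induction k rule: dec_induct)
  case base
  then show ?case using paths_gf_1[of p q] by (simp add: descent_weight_def)
next
  case (step k)
  let ?T = "\<lambda>k i. fps_X ^ (k - i + 1) * fps_const (q ^ descent_weight k i)
    * (1 + fps_const (q ^ (i - 1)) * paths_gf q p p)"
  \<comment> \<open>Starting the descent one letter higher adds one column and the exponent
    \<open>k - 1\<close>.\<close>
  have "fps_X * fps_const (q ^ (k - 1)) * ?T k i = ?T (Suc k) i" if "i \<in> {1..k}" for i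
    using that
    by (simp add: descent_weight_def Suc_diff_le power_add fps_const_mult[symmetric] mult_ac
        del: fps_const_mult Nat.add_diff_assoc)
  then have "fps_X * fps_const (q ^ (k - 1)) * paths_gf q p k = (\<Sum>i = 1..k. ?T (Suc k) i)"
    using step by (simp add: sum_distrib_left)
  moreover have "?T (Suc k) (Suc k) = fps_X * (1 + fps_const (q ^ k) * paths_gf q p p)"
    by (simp add: descent_weight_def)
  ultimately show ?case
    using step paths_gf_Suc[of k p q] by simp
qed

text \<open>The summand 1 is the empty polyomino; all other words are paths from
  \<open>p\<close>.\<close>

lemma fibonacci_gf_eq_paths_gf:
  assumes "1 \<le> p"
  shows "fibonacci_gf p = 1 + paths_gf qvar p p"
proof (rule fps_ext)
  fix n
  let ?U = "{u. fibonacci_word p u \<and> length u = n}"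
  have "inj_on bargraph ?U"
    using inj_on_bargraph[of n] by (rule inj_on_subset) auto
  then have *: "fibonacci_gf p $ n = (\<Sum>u\<in>?U. qvar ^ bargraph_weight u)"
    by (simp add: fibonacci_gf_def fibonacci_polyominoes_def sum.reindex inn_bargraph)
  show "fibonacci_gf p $ n = (1 + paths_gf qvar p p) $ n"
  proof (cases "n = 0")
    case True
    then have "?U = {[]}" by (auto simp: fibonacci_word_def)
    then show ?thesis by (simp only: *) (simp add: paths_gf_def True)
  next
    case False
    then show ?thesis
      using fibonacci_words_eq_paths[OF assms, of n] by (simp add: * paths_gf_def)
  qed
qed

theorem theorem3:
  fixes p :: nat
  assumes "p \<ge> 1"
  shows "fibonacci_gf p =
    1 + (\<Sum>i = 1..p. fps_X ^ (p - i + 1) *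
           fps_const (qvar powi (((int p - int i) * (int p + int i - 3)) div 2)))
      / (1 - (\<Sum>i = 1..p. fps_X ^ (p - i + 1) *
           fps_const (qvar powi (((int p - int i) * (int p + int i - 3) + 2 * (int i - 1)) div 2))))"
proof -
  define N where "N = (\<Sum>i = 1..p. fps_X ^ (p - i + 1) * fps_const (qvar ^ descent_weight p i))"
  define A where "A = (\<Sum>i = 1..p. fps_X ^ (p - i + 1) *
    fps_const (qvar ^ (descent_weight p i + (i - 1))))"
  let ?W = "paths_gf qvar p p"
  \<comment> \<open>Both numerators are even, so \<open>div 2\<close> is exact.\<close>
  have exps: "((int p - int i) * (int p + int i - 3)) div 2 = int (descent_weight p i)"
    "((int p - int i) * (int p + int i - 3) + 2 * (int i - 1)) div 2
      = int (descent_weight p i + (i - 1))"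
    if "i \<in> {1..p}" for i
    using that by (simp_all add: int_descent_weight[symmetric] of_nat_diff)
  have N: "(\<Sum>i = 1..p. fps_X ^ (p - i + 1) *
      fps_const (qvar powi (((int p - int i) * (int p + int i - 3)) div 2))) = N"
    unfolding N_def by (intro sum.cong refl) (simp only: exps power_int_of_nat)
  have A: "(\<Sum>i = 1..p. fps_X ^ (p - i + 1) *
      fps_const (qvar powi (((int p - int i) * (int p + int i - 3) + 2 * (int i - 1)) div 2))) = A"
    unfolding A_def by (intro sum.cong refl) (simp only: exps power_int_of_nat)
  \<comment> \<open>Unrolling at \<open>k = p\<close>: \<open>N\<close> gathers the words that end
    in the first descent, \<open>A\<close> the jumps back to \<open>p\<close>.\<close>
  have "?W = N + A * ?W"
    using paths_gf_unroll[of p p qvar] assms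
    by (simp add: N_def A_def sum.distrib sum_distrib_right distrib_left power_add mult.assoc
        fps_const_mult[symmetric] del: fps_const_mult Nat.add_diff_assoc)
  then have W: "N = ?W * (1 - A)"
    by (simp add: algebra_simps)
  \<comment> \<open>Every summand of \<open>A\<close> has a positive power of \<open>fps_X\<close>,
    so \<open>1 - A\<close> is nonzero and cancels.\<close>
  have "A $ 0 = 0"
    by (simp add: A_def fps_sum_nth mult.assoc)
  then have "1 - A \<noteq> 0"
    by (metis diff_zero fps_one_nth fps_sub_nth fps_zero_nth zero_neq_one)
  then have "N / (1 - A) = ?W"
    unfolding W by simp
  then show ?thesis
    by (simp only: N A fibonacci_gf_eq_paths_gf[OF assms])
qed

end
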